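(* Let $n = p_1^{\alpha_1} p_2^{\alpha_2} \cdots p_k^{\alpha_k}$ be a natural number, where $p_1,\dots,p_k$ are distinct primes and $\alpha_1,\dots,\alpha_k \ge 1$. Then the vertex connectivity of the zero divisor graph $\Gamma[\mathbb{Z}_n]$ is $$\kappa(\Gamma[\mathbb{Z}_n]) = \min\{p_1-1,\, p_2-1,\, \dots,\, p_k-1\}.$$
   Context: $\mathbb{Z}_n$ is the ring of integers modulo $n$. For a commutative ring $R$ with unity, let $Z[R]$ be the set of its zero divisors. The zero divisor graph $\Gamma[R]$ is the simple undirected graph with vertex set $Z^*[R] = Z[R]\setminus\{0\}$ (the non-zero zero divisors of $R$), in which two distinct vertices $v,w$ are adjacent if $vw=0$. The vertex connectivity $\kappa(G)$ of a simple graph $G$ is the smallest number of vertices of $G$ whose deletion from $G$ leaves either a disconnected graph or $K_1$.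
   Formalization: The case k = 1 is stated only for α_1 ≥ 3: for n = p the graph has no vertices, so its connectivity is not p−1, and for n = p² it is the complete graph K_{p−1}, whose connectivity is p−2 and not p−1. *)

theory Defs
  imports "HOL-Number_Theory.Residues" "Graph_Theory.Graph_Theory"
begin

definition zero_divisors :: "('a, 'b) ring_scheme \<Rightarrow> 'a set" where
  "zero_divisors R =
    {a \<in> carrier R. \<exists>b \<in> carrier R - {\<zero>\<^bsub>R\<^esub>}. a \<otimes>\<^bsub>R\<^esub> b = \<zero>\<^bsub>R\<^esub>}"

text \<open>
  Undirected simple graphs are represented, as in the underlying graph library, by symmetric
  loop-free digraphs: every edge contributes both of its orientations. For a commutative ring
  the arc relation below is symmetric.
\<close>

definition zero_divisor_graph :: "('a, 'b) ring_scheme \<Rightarrow> 'a pair_pre_digraph" where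
  "zero_divisor_graph R =
    \<lparr> pverts = zero_divisors R - {\<zero>\<^bsub>R\<^esub>},
      parcs = {(v, w). v \<in> zero_divisors R - {\<zero>\<^bsub>R\<^esub>} \<and> w \<in> zero_divisors R - {\<zero>\<^bsub>R\<^esub>} \<and>
                 v \<noteq> w \<and> v \<otimes>\<^bsub>R\<^esub> w = \<zero>\<^bsub>R\<^esub>} \<rparr>"

text \<open>
  The library's notion of connectedness excludes the null graph. This only matters for the
  null graph itself, whose vertex connectivity is thereby 0: any other finite graph is
  reduced to a single vertex before all of its vertices are gone.
\<close>

definition vertex_connectivity :: "('a, 'b) pre_digraph \<Rightarrow> nat" where
  "vertex_connectivity G =
    (LEAST m. \<exists>S. S \<subseteq> verts G \<and> finite S \<and> card S = m \<and>
       (\<not> Digraph_Component.connected (G \<restriction> (verts G - S)) \<or>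
        complete_digraph 1 (G \<restriction> (verts G - S))))"

end

theory Submission
  imports Defs
begin

text \<open>
  Write \<open>N\<close> for the modulus and let \<open>q\<close> be its least prime divisor. The whole argument rests on one
  count: the nonzero residues that \<open>u\<close> annihilates depend only on \<open>g = gcd u N\<close>, and they are the
  \<open>g - 1\<close> nonzero multiples of \<open>N / g\<close> (\<open>card_nonzero_annihilators\<close>). A vertex \<open>u\<close> has \<open>g > 1\<close>, so
  it annihilates at least \<open>q - 1\<close> vertices, and \<open>u = q\<close> annihilates exactly \<open>q - 1\<close>.

  Upper bound. As \<open>N\<close> does not divide \<open>q\<^sup>2\<close>, the vertex \<open>q\<close> does not annihilate itself, so deleting
  its \<open>q - 1\<close> neighbours isolates it. Its negative \<open>N - q\<close> has the same neighbours and differs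
  from \<open>q\<close>, hence survives too, and the remaining graph is disconnected.

  Lower bound. Delete a set \<open>T\<close> of fewer than \<open>q - 1\<close> vertices and let \<open>u\<close>, \<open>v\<close> be two of the
  remaining ones. If \<open>u\<close>, \<open>v\<close> and \<open>N\<close> have a common divisor above 1, then at least \<open>q - 1\<close> nonzero
  residues annihilate both \<open>u\<close> and \<open>v\<close>, and one of them lies outside \<open>T\<close>. Otherwise every
  annihilator of \<open>u\<close> annihilates every annihilator of \<open>v\<close>; choosing one of each outside \<open>T\<close> gives
  a path \<open>u, x, y, v\<close>. This is \<open>annihilators_avoiding_small_set\<close>. More than one vertex remains,
  because \<open>q\<close> and its \<open>q - 1\<close> neighbours are already \<open>q\<close> vertices.

  The hypotheses guarantee that \<open>N\<close> does not divide \<open>q\<^sup>2\<close>: either \<open>N\<close> has a second prime factor, or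
  it is a power of \<open>q\<close> with exponent at least 3.
\<close>

section \<open>Annihilators modulo N\<close>

definition nonzero_annihilators :: "int \<Rightarrow> int \<Rightarrow> int set" where
  "nonzero_annihilators N u = {x \<in> {0<..<N}. N dvd u * x}"

lemma nonzero_annihilators_gcd:
  "nonzero_annihilators N (gcd u N) = nonzero_annihilators N u"
proof -
  have "N dvd gcd u N * x \<longleftrightarrow> N dvd u * x" for x :: int
  proof
    assume "N dvd gcd u N * x"
    then show "N dvd u * x"
      by (rule dvd_trans) (simp add: mult_dvd_mono)
  next
    assume "N dvd u * x"
    then have "N dvd gcd (x * u) (x * N)"
      by (simp add: mult.commute)
    also have "gcd (x * u) (x * N) = normalize (x * gcd u N)"
      by (metis gcd_mult_left)
    finally show "N dvd gcd u N * x"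
      by (simp add: mult.commute)
  qed
  then show ?thesis
    by (simp add: nonzero_annihilators_def)
qed

text \<open>If \<open>N = d * m\<close>, then \<open>N\<close> divides \<open>d * x\<close> exactly when \<open>m\<close> divides \<open>x\<close>.\<close>

lemma nonzero_annihilators_dvd_eq:
  assumes "d dvd N" "0 < d" "0 < N"
  shows "nonzero_annihilators N d = (\<lambda>j. j * (N div d)) ` {0<..<d}"
proof -
  obtain m where m: "N = d * m"
    using assms(1) by blast
  with assms have "0 < m"
    by (simp add: zero_less_mult_iff)
  have "x \<in> nonzero_annihilators N d \<longleftrightarrow> (\<exists>j \<in> {0<..<d}. x = j * m)" for x
    using \<open>0 < m\<close> \<open>0 < d\<close>
    by (auto simp: nonzero_annihilators_def m dvd_def mult.commute[of m] mult.left_commute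
        zero_less_mult_iff)
  then show ?thesis
    using m \<open>0 < d\<close> by auto
qed

lemma card_nonzero_annihilators:
  assumes "0 < N"
  shows "card (nonzero_annihilators N u) = nat (gcd u N - 1)"
proof -
  have g: "gcd u N dvd N" "0 < gcd u N"
    using assms by auto
  then have "N div gcd u N \<noteq> 0"
    using assms by (auto simp: dvd_div_eq_0_iff)
  then have "inj_on (\<lambda>j. j * (N div gcd u N)) {0<..<gcd u N}"
    by (auto simp: inj_on_def)
  then have "card (nonzero_annihilators N (gcd u N)) = card {0<..<gcd u N}"
    using nonzero_annihilators_dvd_eq[OF g assms] by (simp add: card_image)
  then show ?thesis
    by (simp add: nonzero_annihilators_gcd)
qed

lemma finite_nonzero_annihilators [simp]: "finite (nonzero_annihilators N u)"
  by (rule finite_subset[of _ "{0<..<N}"]) (auto simp: nonzero_annihilators_def)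

text \<open>This is why a nonzero annihilator of a nonzero residue is itself a zero divisor.\<close>

lemma nonzero_annihilators_commute:
  "\<lbrakk>x \<in> nonzero_annihilators N u; u \<in> {0<..<N}\<rbrakk> \<Longrightarrow> u \<in> nonzero_annihilators N x"
  by (simp add: nonzero_annihilators_def mult.commute)

text \<open>
  For two vertices \<open>u\<close> and \<open>v\<close> outside \<open>T\<close>, this gives a walk \<open>u, x, y, v\<close> that avoids \<open>T\<close>. Applied to \<open>d = gcd u v\<close>, the count of annihilators yields a common neighbour \<open>x = y\<close> as soon as
  \<open>d\<close> shares a factor with \<open>N\<close>. If \<open>d\<close> is coprime to \<open>N\<close>, any choice of \<open>x\<close> and \<open>y\<close> works, since
  \<open>N\<close> divides \<open>u * x * y\<close> and \<open>v * x * y\<close>, hence \<open>d * x * y\<close>. A step of the walk may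
  stand still, as \<open>x\<close> may equal \<open>u\<close> and \<open>y\<close> may equal \<open>v\<close>; elements of square zero therefore call
  for no special treatment.
\<close>

lemma annihilators_avoiding_small_set:
  fixes N q :: int
  assumes "0 < N" and least: "\<And>d. \<lbrakk>d dvd N; 1 < d\<rbrakk> \<Longrightarrow> q \<le> d"
    and T: "finite T" "int (card T) < q - 1"
    and u: "\<not> coprime u N" and v: "\<not> coprime v N"
  obtains x y where "x \<in> nonzero_annihilators N u - T" "y \<in> nonzero_annihilators N v - T"
    "N dvd x * y \<or> x = y"
proof -
  have gcd_gt: "1 < gcd w N" if "\<not> coprime w N" for w
    using that \<open>0 < N\<close> by (metis coprime_iff_gcd_eq_1 gcd_pos_int less_irrefl
        int_one_le_iff_zero_less order_le_less)
  have avoid: "\<exists>x. x \<in> nonzero_annihilators N w - T" if "\<not> coprime w N" for w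
  proof -
    have "q \<le> gcd w N"
      using least gcd_gt[OF that] by simp
    then have "card T < card (nonzero_annihilators N w)"
      using T \<open>0 < N\<close> by (simp add: card_nonzero_annihilators)
    then show ?thesis
      using T(1) by (metis all_not_in_conv card_mono Diff_eq_empty_iff not_less)
  qed
  define d where "d = gcd u v"
  show ?thesis
  proof (cases "coprime d N")
    case True
    obtain x y where xy: "x \<in> nonzero_annihilators N u - T" "y \<in> nonzero_annihilators N v - T"
      using avoid u v by blast
    then have "N dvd u * x" "N dvd v * y"
      by (auto simp: nonzero_annihilators_def)
    then have "N dvd (x * y) * u" "N dvd (x * y) * v"
      using dvd_mult2[of N "u * x" y] dvd_mult2[of N "v * y" x] by (simp_all add: mult_ac)
    then have "N dvd gcd ((x * y) * u) ((x * y) * v)"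
      by simp
    also have "gcd ((x * y) * u) ((x * y) * v) = normalize ((x * y) * d)"
      unfolding d_def by (rule gcd_mult_left)
    finally have "N dvd (x * y) * d"
      by simp
    then have "N dvd x * y"
      using True by (simp add: coprime_dvd_mult_left_iff coprime_commute)
    with xy that show ?thesis by blast
  next
    case False
    then obtain x where x: "x \<in> nonzero_annihilators N d - T"
      using avoid by blast
    have "d * x dvd u * x" "d * x dvd v * x"
      by (auto simp: d_def intro: mult_dvd_mono)
    with x have "x \<in> nonzero_annihilators N u - T" "x \<in> nonzero_annihilators N v - T"
      by (auto simp: nonzero_annihilators_def intro: dvd_trans)
    with that show ?thesis by blast
  qed
qed

section \<open>The graph of the integers modulo N\<close>

lemma zero_divisor_graph_residue_ring:
  assumes "1 < N"
  shows "pverts (zero_divisor_graph (residue_ring N)) =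
           {v \<in> {0<..<N}. nonzero_annihilators N v \<noteq> {}}"
    and "parcs (zero_divisor_graph (residue_ring N)) =
           {(v, w). v \<in> pverts (zero_divisor_graph (residue_ring N)) \<and>
                    w \<in> pverts (zero_divisor_graph (residue_ring N)) \<and>
                    v \<noteq> w \<and> N dvd v * w}"
proof -
  have "v \<in> zero_divisors (residue_ring N) - {0} \<longleftrightarrow>
        v \<in> {0<..<N} \<and> nonzero_annihilators N v \<noteq> {}" for v
    by (fastforce simp: zero_divisors_def residue_ring_def nonzero_annihilators_def
        mod_eq_0_iff_dvd)
  moreover have "\<zero>\<^bsub>residue_ring N\<^esub> = 0"
    by (simp add: residue_ring_def)
  ultimately show
    verts: "pverts (zero_divisor_graph (residue_ring N)) =
      {v \<in> {0<..<N}. nonzero_annihilators N v \<noteq> {}}"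
    by (auto simp: zero_divisor_graph_def)
  show "parcs (zero_divisor_graph (residue_ring N)) =
           {(v, w). v \<in> pverts (zero_divisor_graph (residue_ring N)) \<and>
                    w \<in> pverts (zero_divisor_graph (residue_ring N)) \<and>
                    v \<noteq> w \<and> N dvd v * w}"
    by (auto simp: zero_divisor_graph_def residue_ring_def mod_eq_0_iff_dvd)
qed

lemma nonzero_annihilators_subset_verts:
  assumes "u \<in> {0<..<N}" "1 < N"
  shows "nonzero_annihilators N u \<subseteq> pverts (zero_divisor_graph (residue_ring N))"
proof
  fix x assume x: "x \<in> nonzero_annihilators N u"
  then have "u \<in> nonzero_annihilators N x" "x \<in> {0<..<N}"
    using assms(1) nonzero_annihilators_commute by (auto simp: nonzero_annihilators_def)
  then show "x \<in> pverts (zero_divisor_graph (residue_ring N))"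
    by (auto simp: zero_divisor_graph_residue_ring(1)[OF assms(2)])
qed

lemma mem_verts_iff_not_coprime:
  assumes "1 < N"
  shows "v \<in> pverts (zero_divisor_graph (residue_ring N)) \<longleftrightarrow> v \<in> {0<..<N} \<and> \<not> coprime v N"
proof -
  have "nonzero_annihilators N v \<noteq> {} \<longleftrightarrow> card (nonzero_annihilators N v) \<noteq> 0"
    by simp
  also have "\<dots> \<longleftrightarrow> gcd v N \<noteq> 1"
    using assms card_nonzero_annihilators[of N v] gcd_pos_int[of v N] by (simp, linarith)
  finally show ?thesis
    using assms by (auto simp: zero_divisor_graph_residue_ring coprime_iff_gcd_eq_1)
qed

section \<open>Connectivity and deletion of vertices\<close>

lemma not_connected_isolated_vertex:
  assumes "u \<in> verts G" "v \<in> verts G" "u \<noteq> v"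
    and "\<And>w. (u, w) \<notin> arcs_ends G" "\<And>w. (w, u) \<notin> arcs_ends G"
  shows "\<not> Digraph_Component.connected G"
proof
  assume "Digraph_Component.connected G"
  then have "(u, v) \<in> rtrancl_on (verts G) ((arcs_ends G)\<^sup>s)"
    using assms(1,2) by (simp add: connected_conv)
  then show False
    using assms(3-5) by (cases rule: converse_rtrancl_on_cases) (auto simp: symcl_def)
qed

text \<open>
  The last hypothesis rules out every smaller cut: since \<open>K\<^sub>1\<close> has exactly one vertex, a remainder
  that is connected and has another number of vertices meets neither stopping condition.
\<close>

lemma vertex_connectivity_eqI:
  assumes "S \<subseteq> verts G" "finite S" "\<not> Digraph_Component.connected (G \<restriction> (verts G - S))"
    and "\<And>T. \<lbrakk>T \<subseteq> verts G; finite T; card T < card S\<rbrakk> \<Longrightarrow>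
           Digraph_Component.connected (G \<restriction> (verts G - T)) \<and> card (verts G - T) \<noteq> 1"
  shows "vertex_connectivity G = card S"
  unfolding vertex_connectivity_def
proof (rule Least_equality)
  show "\<exists>T\<subseteq>verts G. finite T \<and> card T = card S \<and>
      (\<not> Digraph_Component.connected (G \<restriction> (verts G - T)) \<or>
       complete_digraph 1 (G \<restriction> (verts G - T)))"
    using assms(1-3) by blast
next
  fix m
  assume "\<exists>T\<subseteq>verts G. finite T \<and> card T = m \<and>
      (\<not> Digraph_Component.connected (G \<restriction> (verts G - T)) \<or>
       complete_digraph 1 (G \<restriction> (verts G - T)))"
  then obtain T where T: "T \<subseteq> verts G" "finite T" "card T = m"
      "\<not> Digraph_Component.connected (G \<restriction> (verts G - T)) \<or> card (verts G - T) = 1"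
    by (auto simp: complete_digraph_def)
  then show "card S \<le> m"
    using assms(4)[of T] by force
qed

section \<open>Vertex connectivity of the zero divisor graph\<close>

text \<open>
  The non-emptiness hypothesis is there because connected graphs have at least one vertex by
  definition.
\<close>

lemma connected_delete_few_vertices:
  fixes N q :: int
  assumes "1 < N" and least: "\<And>d. \<lbrakk>d dvd N; 1 < d\<rbrakk> \<Longrightarrow> q \<le> d"
    and T: "finite T" "int (card T) < q - 1"
    and nonempty: "pverts (zero_divisor_graph (residue_ring N)) - T \<noteq> {}"
  shows "Digraph_Component.connected (with_proj (zero_divisor_graph (residue_ring N))
           \<restriction> (pverts (zero_divisor_graph (residue_ring N)) - T))"
    (is "Digraph_Component.connected (?G \<restriction> ?W)")
proof -
  let ?R = "rtrancl_on ?W ((arcs_ends (?G \<restriction> ?W))\<^sup>s)"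
  have step: "(a, b) \<in> ?R" if ab: "a \<in> ?W" "b \<in> ?W" "N dvd a * b \<or> a = b" for a b
  proof (cases "a = b")
    case True
    with ab show ?thesis by auto
  next
    case False
    with ab have "(a, b) \<in> arcs (?G \<restriction> ?W)"
      by (simp add: zero_divisor_graph_residue_ring(2)[OF assms(1)])
    then have "(a, b) \<in> arcs_ends (?G \<restriction> ?W)"
      by (force simp: arcs_ends_conv)
    then have "(a, b) \<in> (arcs_ends (?G \<restriction> ?W))\<^sup>s"
      by (simp add: symcl_def)
    with ab(1,2) show ?thesis
      by (meson converse_rtrancl_on_into_rtrancl_on rtrancl_on_refl)
  qed
  have "(u, v) \<in> ?R" if "u \<in> ?W" "v \<in> ?W" for u v
  proof -
    have uv: "u \<in> {0<..<N}" "v \<in> {0<..<N}" "\<not> coprime u N" "\<not> coprime v N"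
      using that by (auto simp: mem_verts_iff_not_coprime[OF assms(1)])
    obtain x y where x: "x \<in> nonzero_annihilators N u - T"
      and y: "y \<in> nonzero_annihilators N v - T" and xy: "N dvd x * y \<or> x = y"
    proof (rule annihilators_avoiding_small_set[OF _ _ T uv(3,4)])
      show "0 < N"
        using assms(1) by simp
    qed (use least in blast)+
    have "x \<in> ?W" "y \<in> ?W"
      using x y nonzero_annihilators_subset_verts[OF uv(1) assms(1)]
        nonzero_annihilators_subset_verts[OF uv(2) assms(1)] by auto
    moreover have "N dvd u * x" "N dvd y * v"
      using x y by (auto simp: nonzero_annihilators_def mult.commute)
    ultimately have "(u, x) \<in> ?R" "(x, y) \<in> ?R" "(y, v) \<in> ?R"
      using that xy step by blast+
    then show ?thesis
      by (meson rtrancl_on_trans)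
  qed
  then show ?thesis
    using nonempty by (simp add: connected_conv)
qed

text \<open>
  The smallest cut is the set \<open>?S\<close> of neighbours of \<open>q\<close>. That \<open>N\<close> does not divide \<open>q * q\<close> keeps \<open>q\<close>
  and \<open>N - q\<close> out of \<open>?S\<close>; it also makes \<open>q\<close> a nonzero residue by excluding \<open>N = q\<close>.
\<close>

lemma vertex_connectivity_zero_divisor_graph:
  fixes N q :: int
  assumes "0 < N" "prime q" "q dvd N" and least: "\<And>d. \<lbrakk>d dvd N; 1 < d\<rbrakk> \<Longrightarrow> q \<le> d"
    and not_dvd: "\<not> N dvd q * q"
  shows "vertex_connectivity (with_proj (zero_divisor_graph (residue_ring N))) = nat (q - 1)"
proof -
  let ?G = "with_proj (zero_divisor_graph (residue_ring N))"
  let ?S = "nonzero_annihilators N q"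
  have "2 \<le> q"
    using \<open>prime q\<close> by (rule prime_ge_2_int)
  have "q < N"
    using \<open>0 < N\<close> \<open>q dvd N\<close> not_dvd by (metis dvd_triv_left order_le_less zdvd_imp_le)
  then have N: "1 < N"
    using \<open>2 \<le> q\<close> by simp
  have card_S: "card ?S = nat (q - 1)"
    using \<open>0 < N\<close> \<open>q dvd N\<close> \<open>2 \<le> q\<close> by (simp add: card_nonzero_annihilators gcd_proj1_if_dvd)
  have S: "?S \<subseteq> verts ?G"
    using nonzero_annihilators_subset_verts[of q N] \<open>2 \<le> q\<close> \<open>q < N\<close> N by simp
  have "\<not> coprime q N" "\<not> coprime (N - q) N"
    using \<open>2 \<le> q\<close> \<open>q dvd N\<close> by (auto simp: coprime_def intro!: exI[of _ q])
  then have verts: "q \<in> verts ?G" "N - q \<in> verts ?G"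
    using \<open>2 \<le> q\<close> \<open>q < N\<close> by (simp_all add: mem_verts_iff_not_coprime[OF N])
  have notin: "q \<notin> ?S" "N - q \<notin> ?S"
    using not_dvd by (auto simp: nonzero_annihilators_def right_diff_distrib dvd_diff_right_iff)
  have "q \<noteq> N - q"
  proof
    \<comment> \<open>Then \<open>N\<close> is even, so minimality forces \<open>q = 2\<close> and \<open>N = 4 = q * q\<close>.\<close>
    assume "q = N - q"
    then have N2: "N = 2 * q"
      by simp
    then have "q = 2"
      using least[of 2] \<open>2 \<le> q\<close> by simp
    with N2 not_dvd show False
      by simp
  qed
  have "\<not> Digraph_Component.connected (?G \<restriction> (verts ?G - ?S))"
  proof (rule not_connected_isolated_vertex[of q _ "N - q"])
    show "(q, w) \<notin> arcs_ends (?G \<restriction> (verts ?G - ?S))" for w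
      using zero_divisor_graph_residue_ring[OF N]
      by (auto simp: arcs_ends_conv nonzero_annihilators_def)
    show "(w, q) \<notin> arcs_ends (?G \<restriction> (verts ?G - ?S))" for w
      using zero_divisor_graph_residue_ring[OF N]
      by (auto simp: arcs_ends_conv nonzero_annihilators_def mult.commute)
  qed (use verts notin \<open>q \<noteq> N - q\<close> in auto)
  moreover have "Digraph_Component.connected (?G \<restriction> (verts ?G - T)) \<and> card (verts ?G - T) \<noteq> 1"
    if T: "T \<subseteq> verts ?G" "finite T" "card T < card ?S" for T
  proof -
    have fin: "finite (verts ?G)"
      by (rule finite_subset[of _ "{0<..<N}"]) (auto simp: zero_divisor_graph_residue_ring(1)[OF N])
    have "Suc (card ?S) = card (insert q ?S)"
      using notin by simp
    also have "\<dots> \<le> card (verts ?G)"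
      using S verts fin by (intro card_mono) auto
    finally have "2 \<le> card (verts ?G - T)"
      using T card_Diff_subset[of T "verts ?G"] by simp
    moreover from this have "verts ?G - T \<noteq> {}"
      by (metis card.empty not_numeral_le_zero)
    moreover have "int (card T) < q - 1"
      using T(3) card_S by simp
    ultimately show ?thesis
      using connected_delete_few_vertices[OF N least T(2)] by simp
  qed
  ultimately have "vertex_connectivity ?G = card ?S"
    using S by (intro vertex_connectivity_eqI) auto
  with card_S show ?thesis
    by simp
qed

theorem theorem3p5:
  fixes p \<alpha> :: "nat \<Rightarrow> nat" and k n :: nat
  assumes "k \<ge> 1"
    and "\<And>i. i \<in> {1..k} \<Longrightarrow> prime (p i)"
    and "inj_on p {1..k}"
    and "\<And>i. i \<in> {1..k} \<Longrightarrow> \<alpha> i \<ge> 1"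
    and "n = (\<Prod>i = 1..k. p i ^ \<alpha> i)"
    and "k = 1 \<Longrightarrow> \<alpha> 1 \<ge> 3"
  shows "vertex_connectivity (with_proj (zero_divisor_graph (residue_ring (int n)))) =
         Min ((\<lambda>i. p i - 1) ` {1..k})"
proof -
  obtain m where m: "m \<in> {1..k}" and min: "\<And>i. i \<in> {1..k} \<Longrightarrow> p m \<le> p i"
    using assms(1) ex_min_if_finite[of "p ` {1..k}"] by (force simp: not_less)
  define q where "q = p m"
  have q: "prime q"
    using assms(2) m by (simp add: q_def)
  have pow_dvd: "p i ^ \<alpha> i dvd n" if "i \<in> {1..k}" for i
    unfolding assms(5) using that by (intro dvd_prodI) auto
  have p_dvd: "p i dvd n" if "i \<in> {1..k}" for i
    using pow_dvd[OF that] dvd_power[of "\<alpha> i" "p i"] assms(4)[OF that]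
    by (auto intro: dvd_trans)
  have pos: "0 < n"
    unfolding assms(5) using assms(2) by (auto intro!: prod_pos prime_gt_0_nat)
  have least: "q \<le> d" if "d dvd n" "1 < d" for d
  proof -
    obtain r where r: "prime r" "r dvd d"
      using \<open>1 < d\<close> prime_factor_nat[of d] by auto
    then have "r dvd (\<Prod>i = 1..k. p i ^ \<alpha> i)"
      using \<open>d dvd n\<close> assms(5) by (auto intro: dvd_trans)
    then obtain i where "i \<in> {1..k}" "r dvd p i ^ \<alpha> i"
      using r(1) by (auto simp: prime_dvd_prod_iff)
    then have "r = p i"
      using r(1) assms(2) by (meson prime_dvd_power primes_dvd_imp_eq)
    then show ?thesis
      using min[OF \<open>i \<in> {1..k}\<close>] dvd_imp_le[OF r(2)] \<open>1 < d\<close> by (simp add: q_def)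
  qed
  have not_dvd: "\<not> n dvd q * q"
  proof
    assume dvd: "n dvd q * q"
    have "p i = q" if "i \<in> {1..k}" for i
      using dvd_trans[OF p_dvd[OF that] dvd] assms(2)[OF that] q
      by (metis prime_dvd_mult_iff primes_dvd_imp_eq)
    \<comment> \<open>\<open>p\<close> is injective, so \<open>n\<close> is a power of \<open>q\<close>, whose exponent is at least 3 by assumption.\<close>
    then have "{1..k} \<subseteq> {m}"
      using inj_onD[OF assms(3) _ _ m] by (force simp: q_def)
    then have "card {1..k} \<le> 1"
      using card_mono[of "{m}" "{1..k}"] by simp
    then have "k = 1"
      using assms(1) by simp
    then have "m = 1" "3 \<le> \<alpha> 1"
      using m assms(6) by auto
    then have "q ^ 3 dvd q ^ 2"
      using pow_dvd[OF m] dvd le_imp_power_dvd[of 3 "\<alpha> 1" q]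
      by (auto simp: q_def power2_eq_square intro: dvd_trans)
    then show False
      using power_dvd_imp_le[of q 3 2] prime_gt_1_nat[OF q] by simp
  qed
  have "vertex_connectivity (with_proj (zero_divisor_graph (residue_ring (int n)))) = nat (int q - 1)"
  proof (rule vertex_connectivity_zero_divisor_graph)
    show "prime (int q)"
      using q by simp
    show "int q dvd int n"
      using p_dvd[OF m] by (simp add: q_def)
    show "\<not> int n dvd int q * int q"
      using not_dvd by (metis of_nat_dvd_iff of_nat_mult)
    show "int q \<le> d" if "d dvd int n" "1 < d" for d
      using least[of "nat d"] that by (simp add: nat_dvd_iff)
  qed (use pos in simp)
  also have "\<dots> = p m - 1"
    by (simp add: q_def)
  also have "\<dots> = Min ((\<lambda>i. p i - 1) ` {1..k})"
    using m min by (intro Min_eqI[symmetric]) (auto intro: diff_le_mono)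
  finally show ?thesis .
qed

end
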